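(* Let $x\in\mathcal M^B$. For every $v\in V_x^B$ we have $R_x^B(v)\in\mathcal M^B$. Moreover, for every $v\in T_x\mathcal M^B$, writing $c^B(\alpha):=R_x^B(\alpha v)$ for all $\alpha\ge 0$ with $\alpha\|v\|_{\mathcal E}<r_x$, it holds that $$c^B(0)=x,\qquad \left.\frac{d}{d\alpha}c^B(\alpha)\right|_{\alpha=0}=v .$$ Furthermore, $$\left.\frac{d^2}{d\alpha^2}c^B(\alpha)\right|_{\alpha=0}=\Lambda_x\Bigl(\left.\frac{d^2}{d\alpha^2}R_x(\alpha v)\right|_{\alpha=0}\Bigr)=\Lambda_x\bigl(\ell_x(v,v)\bigr),\qquad \Lambda_x:=\mathrm{Id}_{\mathcal E}-P_xB^*L_x^{-1}B:\mathcal E\to\mathcal E .$$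
   Context: $\mathcal E,\mathcal Y$ are real Hilbert spaces. $\mathcal M\subset\mathcal E$ is a $C^2$ embedded submanifold; for $x\in\mathcal M$ the tangent space $T_x\mathcal M$ is identified with a closed linear subspace of $\mathcal E$ with the restricted inner product. $B:\mathcal E\to\mathcal Y$ is a surjective bounded linear operator with adjoint $B^*$, $c\in\mathcal Y$, and $\mathcal M^B:=\{x\in\mathcal M: Bx=c\}$ is nonempty. For each $x\in\mathcal M$ a bounded linear projection $P_x:\mathcal E\to T_x\mathcal M$ onto $T_x\mathcal M$ is given ($P_x^2=P_x$, range $T_x\mathcal M$; not necessarily orthogonal). Standing assumption: for every $x\in\mathcal M^B$, $L_x:=BP_xB^*:\mathcal Y\to\mathcal Y$ is invertible. Then $\mathcal M^B$ is a $C^2$ Hilbert submanifold with $T_x\mathcal M^B=T_x\mathcal M\cap\ker B$, endowed with the ambient inner product $(u,v)_x=(u,v)_{\mathcal E}$. Retraction on $\mathcal M$: for each $x\in\mathcal M$ a $C^2$ map $R_x:T_x\mathcal M\to\mathcal M$ is given with $R_x(0)=x$ and $DR_x(0)=\mathrm{Id}_{T_x\mathcal M}$. The symmetric bounded bilinear map $\ell_x:T_x\mathcal M\times T_x\mathcal M\to\mathcal E$ is determined by $\frac{d^2}{d\alpha^2}R_x(\alpha v)|_{\alpha=0}=\ell_x(v,v)$. Implicit retraction on $\mathcal M^B$: for $x\in\mathcal M^B$, by the implicit function theorem there are $r_x>0$ and a $C^2$ map $\delta_x:V_x^B\to\mathcal Y$, where $V_x^B:=\{v\in T_x\mathcal M^B:\|v\|_{\mathcal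 E}<r_x\}$, such that $\delta_x(0)=0$ and $B R_x(v-P_xB^*\delta_x(v))=c$ for all $v\in V_x^B$. Fix such $r_x,\delta_x$ and set $R_x^B(v):=R_x(v-P_xB^*\delta_x(v))$ for $v\in V_x^B$. *)

theory Defs
  imports "HOL-Analysis.Analysis"
begin

text \<open>
  C^2 regularity. Intended for sets S that are relatively open in a closed linear subspace V of a
  Hilbert space (V is the whole space for open S). Then f' x and f'' x are determined on V only;
  letting them live on the whole space costs nothing, since bounded linear maps on V extend along
  the orthogonal projection onto V.
\<close>

definition C2_on :: "('a::real_normed_vector \<Rightarrow> 'b::real_normed_vector) \<Rightarrow> 'a set \<Rightarrow> bool"
  where "C2_on f S \<longleftrightarrow>
    (\<exists>(f' :: 'a \<Rightarrow> 'a \<Rightarrow>\<^sub>L 'b) (f'' :: 'a \<Rightarrow> 'a \<Rightarrow>\<^sub>L ('a \<Rightarrow>\<^sub>L 'b)).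
       (\<forall>x\<in>S. (f has_derivative blinfun_apply (f' x)) (at x within S)) \<and>
       (\<forall>x\<in>S. (f' has_derivative blinfun_apply (f'' x)) (at x within S)) \<and>
       continuous_on S f'')"

definition has_second_vector_derivative ::
    "(real \<Rightarrow> 'a::real_normed_vector) \<Rightarrow> 'a \<Rightarrow> real \<Rightarrow> real set \<Rightarrow> bool"
  where "has_second_vector_derivative f a t S \<longleftrightarrow>
    (\<exists>f'. (\<forall>s\<in>S. (f has_vector_derivative f' s) (at s within S)) \<and>
          (f' has_vector_derivative a) (at t within S))"

text \<open>Closed subspaces of a Hilbert space are complemented, so every closed subspace F is an
  admissible model space of the submanifold in a chart.\<close>

definition C2_embedded_submanifold :: "'e::{real_inner,complete_space} set \<Rightarrow> bool"
  where "C2_embedded_submanifold M \<longleftrightarrow>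
    (\<forall>x\<in>M. \<exists>U (\<phi> :: 'e \<Rightarrow> 'e) \<psi> F.
       open U \<and> x \<in> U \<and> open (\<phi> ` U) \<and> C2_on \<phi> U \<and> C2_on \<psi> (\<phi> ` U) \<and>
       (\<forall>u\<in>U. \<psi> (\<phi> u) = u) \<and>
       subspace F \<and> closed F \<and> \<phi> ` (U \<inter> M) = \<phi> ` U \<inter> F)"

definition tangent_space :: "'e::real_normed_vector set \<Rightarrow> 'e \<Rightarrow> 'e set"
  where "tangent_space M x =
    {v. \<exists>\<gamma> \<epsilon>. 0 < \<epsilon> \<and> \<gamma> C1_differentiable_on {-\<epsilon><..<\<epsilon>} \<and> \<gamma> ` {-\<epsilon><..<\<epsilon>} \<subseteq> M \<and>
           \<gamma> 0 = x \<and> (\<gamma> has_vector_derivative v) (at 0)}"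

definition bounded_projection_onto :: "'e::real_normed_vector set \<Rightarrow> ('e \<Rightarrow> 'e) \<Rightarrow> bool"
  where "bounded_projection_onto T P \<longleftrightarrow> bounded_linear P \<and> P \<circ> P = P \<and> range P = T"

definition C2_retraction_at :: "'e::real_normed_vector set \<Rightarrow> 'e \<Rightarrow> ('e \<Rightarrow> 'e) \<Rightarrow> bool"
  where "C2_retraction_at M x R \<longleftrightarrow>
    R ` tangent_space M x \<subseteq> M \<and> C2_on R (tangent_space M x) \<and> R 0 = x \<and>
    (R has_derivative (\<lambda>h. h)) (at 0 within tangent_space M x)"

definition symmetric_bounded_bilinear_on ::
    "'e::real_normed_vector set \<Rightarrow> ('e \<Rightarrow> 'e \<Rightarrow> 'b::real_normed_vector) \<Rightarrow> bool"
  where "symmetric_bounded_bilinear_on T b \<longleftrightarrow>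
    (\<forall>u\<in>T. \<forall>v\<in>T. b u v = b v u) \<and>
    (\<forall>u\<in>T. \<forall>v\<in>T. \<forall>w\<in>T. \<forall>s t. b (s *\<^sub>R u + t *\<^sub>R v) w = s *\<^sub>R b u w + t *\<^sub>R b v w) \<and>
    (\<exists>K. \<forall>u\<in>T. \<forall>v\<in>T. norm (b u v) \<le> K * norm u * norm v)"

definition constrained_set :: "'e set \<Rightarrow> ('e \<Rightarrow> 'y) \<Rightarrow> 'y \<Rightarrow> 'e set"
  where "constrained_set M B c = {x\<in>M. B x = c}"

definition constraint_operator ::
    "('e::real_inner \<Rightarrow> 'y::real_inner) \<Rightarrow> ('e \<Rightarrow> 'e) \<Rightarrow> 'y \<Rightarrow> 'y"
  where "constraint_operator B P = B \<circ> P \<circ> adjoint B"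

definition correction_operator ::
    "('e::real_inner \<Rightarrow> 'y::real_inner) \<Rightarrow> ('e \<Rightarrow> 'e) \<Rightarrow> 'e \<Rightarrow> 'e"
  where "correction_operator B P w = w - P (adjoint B (inv (constraint_operator B P) (B w)))"

definition implicit_domain :: "'e::real_normed_vector set \<Rightarrow> 'e \<Rightarrow> real \<Rightarrow> 'e set"
  where "implicit_domain N x r = {v \<in> tangent_space N x. norm v < r}"

definition implicit_retraction ::
    "('e::real_inner \<Rightarrow> 'y::real_inner) \<Rightarrow> ('e \<Rightarrow> 'e) \<Rightarrow> ('e \<Rightarrow> 'e) \<Rightarrow> ('e \<Rightarrow> 'y) \<Rightarrow> 'e \<Rightarrow> 'e"
  where "implicit_retraction B P R \<delta> v = R (v - P (adjoint B (\<delta> v)))"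

end

theory Submission
  imports Defs
begin

text \<open>
  Write \<open>Q = P\<^sub>x B\<^sup>*\<close> and \<open>L = B Q\<close>, and fix a tangent vector \<open>v\<close> of the constrained set at \<open>x\<close>.
  The curve in question is \<open>cB(s) = R\<^sub>x(\<gamma>(s))\<close> with \<open>\<gamma>(s) = s v - Q d(s)\<close> and
  \<open>d(s) = \<delta>\<^sub>x(s v)\<close>. It satisfies \<open>B cB(s) = c\<close> for all admissible \<open>s\<close>, and everything follows by
  differentiating this identity twice at \<open>s = 0\<close>, where \<open>\<gamma>(0) = 0\<close> and \<open>DR\<^sub>x(0)\<close> is the identity of
  the tangent space.

  The first derivative gives \<open>B (v - Q d'(0)) = 0\<close>. Since \<open>B v = 0\<close>, this says \<open>L d'(0) = 0\<close>, so
  \<open>d'(0) = 0\<close> by injectivity of \<open>L\<close>, and the initial velocity is \<open>v\<close>. By the second-order chain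
  rule, the initial acceleration is then \<open>D\<^sup>2R\<^sub>x(0)(v, v) - Q d''(0)\<close>, where
  \<open>D\<^sup>2R\<^sub>x(0)(v, v) = l\<^sub>x(v, v)\<close> because both are the acceleration of \<open>s \<mapsto> R\<^sub>x(s v)\<close>. The second
  derivative of the constraint gives \<open>B l\<^sub>x(v, v) = L d''(0)\<close>; solving for \<open>d''(0)\<close> turns the
  acceleration into \<open>l\<^sub>x(v, v) - Q L\<^sup>-\<^sup>1 B l\<^sub>x(v, v)\<close>, which is the claim. The lemma
  \<open>implicit_curve_derivatives\<close> carries out this computation.

  The chain rule needs \<open>Q\<close> to be bounded and linear, hence the adjoint of \<open>B\<close> has to be a genuine
  one. The constant \<open>adjoint\<close> is a choice operator; that a function with the adjoint property exists
  in a Hilbert space of arbitrary dimension is the Riesz representation theorem, proved below.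
\<close>

section \<open>Riesz representation and Hilbert space adjoints\<close>

text \<open>
  The direct method: by the parallelogram law the energy \<open>J x = \<parallel>x\<parallel>\<^sup>2/2 - f x\<close> is uniformly convex,
  so a minimizing sequence is Cauchy, and completeness supplies its limit.
\<close>

lemma bounded_linear_functional_minimizer:
  fixes f :: "'a::{real_inner,complete_space} \<Rightarrow> real"
  assumes f: "bounded_linear f"
  obtains z where "\<And>x. inner z z / 2 - f z \<le> inner x x / 2 - f x"
proof -
  interpret f: bounded_linear f by (fact f)
  define J where "J = (\<lambda>x. inner x x / 2 - f x)"
  obtain K where K: "\<And>x. norm (f x) \<le> norm x * K" using f.bounded by blast
  have lower: "- (K\<^sup>2 / 2) \<le> J x" for x
  proof -
    have "f x \<le> norm x * K" using K[of x] by simp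
    moreover have "0 \<le> (norm x - K)\<^sup>2" by simp
    ultimately show ?thesis
      unfolding J_def by (simp add: power2_norm_eq_inner[symmetric] power2_diff)
  qed
  define m where "m = Inf (range J)"
  have bdd: "bdd_below (range J)" using lower by (auto intro!: bdd_belowI)
  have m_le: "m \<le> J x" for x unfolding m_def using bdd by (auto intro: cInf_lower)
  have "\<exists>x. J x < m + 1 / Suc n" for n
  proof -
    have "Inf (range J) < m + 1 / Suc n" by (simp add: m_def)
    then show ?thesis using cInf_lessD[of "range J"] by blast
  qed
  then obtain X where X: "\<And>n. J (X n) < m + 1 / Suc n" by metis
  \<comment> \<open>Two points of almost minimal energy are close, since their midpoint has energy at least \<open>m\<close>.\<close>
  have gap: "(dist x y)\<^sup>2 \<le> 4 * ((J x - m) + (J y - m))" for x y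
  proof -
    have "(dist x y)\<^sup>2 / 4 = J x + J y - 2 * J ((1/2) *\<^sub>R (x + y))"
      by (simp add: J_def dist_norm power2_norm_eq_inner inner_diff_left inner_diff_right
          inner_add_left inner_add_right inner_commute f.add f.scaleR field_simps)
    then show ?thesis using m_le[of "(1/2) *\<^sub>R (x + y)"] by simp
  qed
  have "Cauchy X"
  proof (rule metric_CauchyI)
    fix e :: real assume e: "0 < e"
    then obtain N where N: "1 / real (Suc N) < e\<^sup>2 / 8"
      using nat_approx_posE[of "e\<^sup>2/8"] by (metis divide_pos_pos zero_less_numeral zero_less_power)
    have near: "J (X n) - m < e\<^sup>2 / 8" if "N \<le> n" for n
    proof -
      have "1 / real (Suc n) \<le> 1 / real (Suc N)" using that by (simp add: frac_le)
      then show ?thesis using X[of n] N by linarith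
    qed
    have "dist (X a) (X b) < e" if "N \<le> a" "N \<le> b" for a b
    proof -
      have "(dist (X a) (X b))\<^sup>2 \<le> 4 * ((J (X a) - m) + (J (X b) - m))" by (rule gap)
      also have "\<dots> < 4 * (e\<^sup>2 / 8 + e\<^sup>2 / 8)"
        using near[OF that(1)] near[OF that(2)] by (intro mult_strict_left_mono add_strict_mono) auto
      finally have "(dist (X a) (X b))\<^sup>2 < e\<^sup>2" by simp
      then show ?thesis using e by (meson less_imp_le power2_less_imp_less)
    qed
    then show "\<exists>M. \<forall>a\<ge>M. \<forall>b\<ge>M. dist (X a) (X b) < e" by blast
  qed
  then obtain z where z: "X \<longlonglongrightarrow> z" using Cauchy_convergent convergent_def by blast
  have "(\<lambda>n. J (X n)) \<longlonglongrightarrow> J z"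
    unfolding J_def by (intro tendsto_intros z f.tendsto) auto
  moreover have "(\<lambda>n. m + 1 / real (Suc n)) \<longlonglongrightarrow> m + 0"
    by (intro tendsto_intros LIMSEQ_inverse_real_of_nat[unfolded inverse_eq_divide])
  ultimately have "J z \<le> m + 0"
    by (rule LIMSEQ_le) (use X less_imp_le in blast)
  then have "J z \<le> J x" for x using m_le[of x] by simp
  then show thesis using that unfolding J_def by blast
qed

text \<open>
  The representing vector is the minimizer \<open>z\<close> of the energy: the first variation in direction \<open>h\<close>,
  which is \<open>inner h z - f h\<close>, has to vanish.
\<close>

lemma riesz_representation:
  fixes f :: "'a::{real_inner,complete_space} \<Rightarrow> real"
  assumes f: "bounded_linear f"
  obtains z where "\<And>x. f x = inner x z"
proof -
  interpret f: bounded_linear f by (fact f)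
  obtain z where z: "\<And>x. inner z z / 2 - f z \<le> inner x x / 2 - f x"
    using bounded_linear_functional_minimizer[OF f] by blast
  have "f h = inner h z" for h
  proof (cases "h = 0")
    case False
    define a where "a = inner h z - f h"
    define q where "q = inner h h"
    have q: "0 < q" using False by (simp add: q_def)
    have var: "0 \<le> t * a + t\<^sup>2 * q / 2" for t
    proof -
      have "inner (z + t *\<^sub>R h) (z + t *\<^sub>R h) / 2 - f (z + t *\<^sub>R h)
          = inner z z / 2 - f z + (t * a + t\<^sup>2 * q / 2)"
        by (simp add: a_def q_def inner_add_left inner_add_right inner_commute f.add f.scaleR
            power2_eq_square field_simps)
      then show ?thesis using z[of "z + t *\<^sub>R h"] by linarith
    qed
    \<comment> \<open>The quadratic in \<open>t\<close> is smallest at \<open>t = - a / q\<close>, where its value is negative unless \<open>a = 0\<close>.\<close>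
    have "- a / q * a + (- a / q)\<^sup>2 * q / 2 = - (a\<^sup>2 / (2 * q))"
      using q by (simp add: power2_eq_square field_simps)
    then have "a\<^sup>2 / (2 * q) \<le> 0" using var[of "- a / q"] by simp
    then have "a = 0" using q by (simp add: divide_le_0_iff)
    then show ?thesis by (simp add: a_def)
  qed simp
  then show thesis using that by blast
qed

lemma adjoint_hilbert:
  fixes B :: "'e::{real_inner,complete_space} \<Rightarrow> 'y::real_inner"
  assumes B: "bounded_linear B"
  shows "inner (B x) y = inner x (adjoint B y)"
proof -
  have "\<exists>w. \<forall>x. inner (B x) y = inner x w" for y
    using riesz_representation[OF bounded_linear_compose[OF bounded_linear_inner_left B], of y]
    by metis
  then have "\<exists>g. \<forall>x y. inner (B x) y = inner x (g y)" by metis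
  then have "\<forall>x y. inner (B x) y = inner x (adjoint B y)"
    unfolding adjoint_def by (rule someI_ex)
  then show ?thesis by blast
qed

text \<open>
  Boundedness comes from \<open>\<parallel>B\<^sup>* y\<parallel>\<^sup>2 = inner (B (B\<^sup>* y)) y \<le> K \<parallel>B\<^sup>* y\<parallel> \<parallel>y\<parallel>\<close>.
\<close>

lemma bounded_linear_adjoint:
  fixes B :: "'e::{real_inner,complete_space} \<Rightarrow> 'y::real_inner"
  assumes B: "bounded_linear B"
  shows "bounded_linear (adjoint B)"
proof -
  interpret B: bounded_linear B by (fact B)
  note adj = adjoint_hilbert[OF B]
  obtain K where K: "\<And>x. norm (B x) \<le> norm x * K" "0 < K" using B.pos_bounded by blast
  show ?thesis
  proof (rule bounded_linear_intro)
    show "adjoint B (y + z) = adjoint B y + adjoint B z" for y z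
      by (rule vector_eq_ldot[THEN iffD1]) (simp add: adj[symmetric] inner_add_right)
    show "adjoint B (t *\<^sub>R y) = t *\<^sub>R adjoint B y" for t y
      by (rule vector_eq_ldot[THEN iffD1]) (simp add: adj[symmetric])
    show "norm (adjoint B y) \<le> norm y * K" for y
    proof -
      let ?n = "norm (adjoint B y)"
      have "?n * ?n = inner (B (adjoint B y)) y"
        by (simp add: adj power2_norm_eq_inner[symmetric] power2_eq_square)
      also have "\<dots> \<le> norm (B (adjoint B y)) * norm y" by (rule norm_cauchy_schwarz)
      also have "\<dots> \<le> (?n * K) * norm y" by (intro mult_right_mono K) simp
      finally have *: "?n * ?n \<le> ?n * (norm y * K)" by (simp add: ac_simps)
      show ?thesis
      proof (cases "?n = 0")
        case True
        then show ?thesis using K(2) by simp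
      next
        case False
        then show ?thesis using * by simp
      qed
    qed
  qed
qed

section \<open>Second derivatives along curves\<close>

text \<open>
  The second-order chain rule, relative to sets: \<open>F\<close> is differentiable only within \<open>S\<close>, and the
  curve stays in \<open>S\<close>. The retraction lives on a closed subspace and the implicit function on part of
  one, so neither is differentiable in an open set of the ambient space.
\<close>

lemma second_derivative_along_curve:
  fixes F :: "'a::real_normed_vector \<Rightarrow> 'b::real_normed_vector"
    and F' :: "'a \<Rightarrow> 'a \<Rightarrow>\<^sub>L 'b" and F'' :: "'a \<Rightarrow> 'a \<Rightarrow>\<^sub>L ('a \<Rightarrow>\<^sub>L 'b)"
  assumes F1: "\<And>u. u \<in> S \<Longrightarrow> (F has_derivative blinfun_apply (F' u)) (at u within S)"
    and F2: "\<And>u. u \<in> S \<Longrightarrow> (F' has_derivative blinfun_apply (F'' u)) (at u within S)"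
    and \<gamma>S: "\<And>s. s \<in> I \<Longrightarrow> \<gamma> s \<in> S"
    and \<gamma>1: "\<And>s. s \<in> I \<Longrightarrow> (\<gamma> has_vector_derivative \<gamma>' s) (at s within I)"
    and \<gamma>2: "(\<gamma>' has_vector_derivative \<gamma>2) (at t within I)"
    and t: "t \<in> I"
  shows "\<And>s. s \<in> I \<Longrightarrow> ((\<lambda>s. F (\<gamma> s)) has_vector_derivative F' (\<gamma> s) (\<gamma>' s)) (at s within I)"
    and "((\<lambda>s. F' (\<gamma> s) (\<gamma>' s)) has_vector_derivative
            F'' (\<gamma> t) (\<gamma>' t) (\<gamma>' t) + F' (\<gamma> t) \<gamma>2) (at t within I)"
proof -
  have sub: "\<gamma> ` I \<subseteq> S" using \<gamma>S by blast
  show "((\<lambda>s. F (\<gamma> s)) has_vector_derivative F' (\<gamma> s) (\<gamma>' s)) (at s within I)" if "s \<in> I" for s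
    using vector_derivative_diff_chain_within[OF \<gamma>1[OF that]
        has_derivative_subset[OF F1[OF \<gamma>S[OF that]] sub]]
    by (simp add: o_def)
  have "((\<lambda>s. F' (\<gamma> s)) has_vector_derivative F'' (\<gamma> t) (\<gamma>' t)) (at t within I)"
    using vector_derivative_diff_chain_within[OF \<gamma>1[OF t]
        has_derivative_subset[OF F2[OF \<gamma>S[OF t]] sub]]
    by (simp add: o_def)
  from bounded_bilinear.has_vector_derivative[OF bounded_bilinear_blinfun_apply this \<gamma>2]
  show "((\<lambda>s. F' (\<gamma> s) (\<gamma>' s)) has_vector_derivative
            F'' (\<gamma> t) (\<gamma>' t) (\<gamma>' t) + F' (\<gamma> t) \<gamma>2) (at t within I)"
    by (simp add: add.commute)
qed

text \<open>
  Uniqueness is applied twice to the velocity field: its values on all of \<open>S\<close> are determined, and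
  therefore so is its derivative at \<open>t\<close>. This is why every point of \<open>S\<close> must be a limit point.
\<close>

lemma has_second_vector_derivative_unique:
  assumes a: "has_second_vector_derivative f a t S" and b: "has_second_vector_derivative f b t S"
    and S: "\<And>s. s \<in> S \<Longrightarrow> at s within S \<noteq> bot" and t: "t \<in> S"
  shows "a = b"
proof -
  obtain f1 where f1: "\<And>s. s \<in> S \<Longrightarrow> (f has_vector_derivative f1 s) (at s within S)"
      and f1t: "(f1 has_vector_derivative a) (at t within S)"
    using a unfolding has_second_vector_derivative_def by blast
  obtain f2 where f2: "\<And>s. s \<in> S \<Longrightarrow> (f has_vector_derivative f2 s) (at s within S)"
      and f2t: "(f2 has_vector_derivative b) (at t within S)"
    using b unfolding has_second_vector_derivative_def by blast
  have eq: "f1 s = f2 s" if "s \<in> S" for s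
    using vector_derivative_unique_within[OF S[OF that] f1[OF that] f2[OF that]] .
  have "(f1 has_vector_derivative b) (at t within S)"
    by (rule has_vector_derivative_transform[OF t _ f2t]) (simp add: eq)
  then show ?thesis using vector_derivative_unique_within[OF S[OF t] f1t] by blast
qed

text \<open>
  The set is the parameter interval of a curve whose initial velocity has norm \<open>n\<close>: \<open>[0, r / n)\<close>, or
  the half line if \<open>n = 0\<close>. Being half-open, it continues to the right of each of its points, so
  one-sided derivatives are determined even at the endpoint \<open>0\<close>.
\<close>

lemma at_within_ray_nontrivial:
  fixes n r :: real
  assumes r: "0 < r" and n: "0 \<le> n" and s: "s \<in> {\<alpha>. 0 \<le> \<alpha> \<and> \<alpha> * n < r}"
  shows "at s within {\<alpha>. 0 \<le> \<alpha> \<and> \<alpha> * n < r} \<noteq> bot"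
proof -
  obtain b where b: "s < b" "b * n < r"
  proof (cases "n = 0")
    case True
    then show thesis using r that[of "s + 1"] by simp
  next
    case False
    then have "s < r / n" using s n by (simp add: pos_less_divide_eq)
    then obtain b where "s < b" "b < r / n" using dense by blast
    then show thesis using that False n by (simp add: pos_less_divide_eq)
  qed
  have "{s..b} \<subseteq> {\<alpha>. 0 \<le> \<alpha> \<and> \<alpha> * n < r}"
  proof
    fix \<alpha> assume \<alpha>: "\<alpha> \<in> {s..b}"
    then have "\<alpha> * n \<le> b * n" using n by (intro mult_right_mono) auto
    then show "\<alpha> \<in> {\<alpha>. 0 \<le> \<alpha> \<and> \<alpha> * n < r}" using \<alpha> b s by auto
  qed
  moreover have "s islimpt {s..b}" using b(1) by simp
  ultimately show ?thesis by (meson islimpt_subset trivial_limit_within)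
qed

section \<open>Tangent vectors of a constrained set\<close>

lemma tangent_space_mono: "N \<subseteq> M \<Longrightarrow> tangent_space N x \<subseteq> tangent_space M x"
  unfolding tangent_space_def by blast

lemma tangent_space_constrained_set_in_kernel:
  assumes B: "bounded_linear B" and v: "v \<in> tangent_space (constrained_set M B c) x"
  shows "B v = 0"
proof -
  interpret B: bounded_linear B by (fact B)
  obtain \<gamma> \<epsilon> where e: "0 < \<epsilon>" and im: "\<gamma> ` {-\<epsilon><..<\<epsilon>} \<subseteq> constrained_set M B c"
    and d: "(\<gamma> has_vector_derivative v) (at 0)"
    using v unfolding tangent_space_def by blast
  have "((\<lambda>s. B (\<gamma> s)) has_vector_derivative B v) (at 0)"
    by (rule B.has_vector_derivative[OF d])
  moreover have "((\<lambda>s. B (\<gamma> s)) has_vector_derivative 0) (at 0)"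
  proof (rule has_vector_derivative_transform_within_open[where S="{-\<epsilon><..<\<epsilon>}"])
    show "((\<lambda>s. c) has_vector_derivative 0) (at 0)" by simp
    show "c = B (\<gamma> s)" if "s \<in> {-\<epsilon><..<\<epsilon>}" for s
      using im imageI[OF that, of \<gamma>] by (auto simp: constrained_set_def)
  qed (use e in auto)
  ultimately show ?thesis by (rule vector_derivative_unique_at)
qed

text \<open>
  Reparametrize the curve by \<open>s \<mapsto> t s\<close>. This makes the whole ray through a tangent vector, and not
  just one point of it, available as a path in the domain of the implicit function.
\<close>

lemma tangent_space_scaleR:
  assumes v: "v \<in> tangent_space M x"
  shows "t *\<^sub>R v \<in> tangent_space M x"
proof -
  obtain \<gamma> \<epsilon> D where e: "0 < \<epsilon>" and im: "\<gamma> ` {-\<epsilon><..<\<epsilon>} \<subseteq> M" and 0: "\<gamma> 0 = x"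
    and d: "(\<gamma> has_vector_derivative v) (at 0)"
    and D: "\<And>s. s \<in> {-\<epsilon><..<\<epsilon>} \<Longrightarrow> (\<gamma> has_vector_derivative D s) (at s)"
    and Dc: "continuous_on {-\<epsilon><..<\<epsilon>} D"
    using v unfolding tangent_space_def C1_differentiable_on_def by blast
  \<comment> \<open>The summand \<open>1\<close> keeps the denominator positive for \<open>t = 0\<close>, where the new curve is constant.\<close>
  define \<eta> where "\<eta> = \<epsilon> / (\<bar>t\<bar> + 1)"
  have \<eta>: "0 < \<eta>" using e by (simp add: \<eta>_def)
  have mem: "t * s \<in> {-\<epsilon><..<\<epsilon>}" if "s \<in> {-\<eta><..<\<eta>}" for s
  proof -
    have "\<bar>t * s\<bar> \<le> (\<bar>t\<bar> + 1) * \<bar>s\<bar>" by (simp add: abs_mult mult_right_mono)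
    also have "\<dots> < (\<bar>t\<bar> + 1) * \<eta>" using that by (intro mult_strict_left_mono) auto
    also have "\<dots> = \<epsilon>" by (simp add: \<eta>_def)
    finally show ?thesis by (auto simp: abs_less_iff)
  qed
  have chain: "((\<lambda>s. \<gamma> (t * s)) has_vector_derivative t *\<^sub>R w) (at s)"
    if "(\<gamma> has_vector_derivative w) (at (t * s))" for s w
  proof -
    have "((*) t has_vector_derivative t) (at s)"
      by (auto intro!: derivative_eq_intros)
    then show ?thesis using vector_diff_chain_at[of "(*) t" t s \<gamma> w] that by (simp add: o_def)
  qed
  have "(\<lambda>s. \<gamma> (t * s)) C1_differentiable_on {-\<eta><..<\<eta>}"
    unfolding C1_differentiable_on_def
  proof (intro exI[of _ "\<lambda>s. t *\<^sub>R D (t * s)"] conjI ballI)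
    show "continuous_on {-\<eta><..<\<eta>} (\<lambda>s. t *\<^sub>R D (t * s))"
      using mem by (intro continuous_intros continuous_on_compose2[OF Dc]) auto
  qed (use chain D mem in blast)
  moreover have "((\<lambda>s. \<gamma> (t * s)) has_vector_derivative t *\<^sub>R v) (at 0)"
    using chain[of v 0] d by simp
  moreover have "(\<lambda>s. \<gamma> (t * s)) ` {-\<eta><..<\<eta>} \<subseteq> M" using im mem by blast
  ultimately show ?thesis using \<eta> 0 unfolding tangent_space_def
    by (intro CollectI exI[of _ "\<lambda>s. \<gamma> (t * s)"] exI[of _ \<eta>]) simp
qed

text \<open>
  Derivatives within a proper subspace are not unique as maps on the whole space, but their values on
  the subspace are: restrict to the line through \<open>v\<close>. This identifies the derivative of a retraction
  at the origin with the identity on the tangent space.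
\<close>

lemma has_derivative_within_subspace_unique:
  assumes f: "(f has_derivative f') (at 0 within T)" and g: "(f has_derivative g') (at 0 within T)"
    and T: "subspace T" and v: "v \<in> T"
  shows "f' v = g' v"
proof -
  have line: "((\<lambda>s. s *\<^sub>R v) has_vector_derivative v) (at 0)"
    by (auto intro!: derivative_eq_intros)
  have sub: "range (\<lambda>s. s *\<^sub>R v) \<subseteq> T" using T v by (auto simp: subspace_def)
  have "((\<lambda>s. f (s *\<^sub>R v)) has_vector_derivative h v) (at 0)"
    if "(f has_derivative h) (at 0 within T)" for h
    using vector_derivative_diff_chain_within[OF line, of f h] has_derivative_subset[OF that sub]
    by (simp add: o_def)
  from vector_derivative_unique_at[OF this[OF f] this[OF g]] show ?thesis .
qed

section \<open>Differentiating the constraint\<close>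

text \<open>
  The heart of the matter. Differentiating the constraint once shows \<open>(B \<circ> Q) (d' 0) = 0\<close>, hence
  \<open>d' 0 = 0\<close>, so the correction \<open>Q (d s)\<close> affects the curve only to second order. Differentiating it
  again determines \<open>d2\<close> through the equation in the third conclusion.
\<close>

lemma implicit_curve_derivatives:
  fixes R :: "'e::real_normed_vector \<Rightarrow> 'e" and B :: "'e \<Rightarrow> 'y::real_normed_vector"
    and Q :: "'y \<Rightarrow> 'e" and d d' :: "real \<Rightarrow> 'y"
  assumes T: "subspace T" and v: "v \<in> T"
    and R1: "\<And>u. u \<in> T \<Longrightarrow> (R has_derivative blinfun_apply (R' u)) (at u within T)"
    and R2: "\<And>u. u \<in> T \<Longrightarrow> (R' has_derivative blinfun_apply (R'' u)) (at u within T)"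
    and R0: "\<And>u. u \<in> T \<Longrightarrow> R' 0 u = u"
    and B: "bounded_linear B" and Bv: "B v = 0"
    and Q: "bounded_linear Q" and QT: "range Q \<subseteq> T" and inj: "inj (B \<circ> Q)"
    and d0: "d 0 = 0"
    and d1: "\<And>s. s \<in> I \<Longrightarrow> (d has_vector_derivative d' s) (at s within I)"
    and d2: "(d' has_vector_derivative d2) (at 0 within I)"
    and I: "0 \<in> I" "\<And>s. s \<in> I \<Longrightarrow> at s within I \<noteq> bot"
    and constraint: "\<And>s. s \<in> I \<Longrightarrow> B (R (s *\<^sub>R v - Q (d s))) = c"
  shows "((\<lambda>s. R (s *\<^sub>R v - Q (d s))) has_vector_derivative v) (at 0 within I)"
    and "has_second_vector_derivative (\<lambda>s. R (s *\<^sub>R v - Q (d s))) (R'' 0 v v - Q d2) 0 I"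
    and "B (Q d2) = B (R'' 0 v v)"
proof -
  interpret B: bounded_linear B by (fact B)
  interpret Q: bounded_linear Q by (fact Q)
  define \<gamma> where "\<gamma> = (\<lambda>s. s *\<^sub>R v - Q (d s))"
  have \<gamma>T: "\<gamma> s \<in> T" for s
    unfolding \<gamma>_def using T v QT by (intro subspace_diff subspace_scale) auto
  have \<gamma>1: "(\<gamma> has_vector_derivative v - Q (d' s)) (at s within I)" if "s \<in> I" for s
    unfolding \<gamma>_def
    by (auto intro!: derivative_eq_intros Q.has_vector_derivative[OF d1[OF that]])
  have \<gamma>2: "((\<lambda>s. v - Q (d' s)) has_vector_derivative - Q d2) (at 0 within I)"
    by (auto intro!: derivative_eq_intros Q.has_vector_derivative[OF d2])
  have along1: "((\<lambda>s. R (\<gamma> s)) has_vector_derivative R' (\<gamma> s) (v - Q (d' s))) (at s within I)"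
    if "s \<in> I" for s
    by (rule second_derivative_along_curve(1)[OF R1 R2 \<gamma>T \<gamma>1 \<gamma>2 I(1) that])
  have along2: "((\<lambda>s. R' (\<gamma> s) (v - Q (d' s))) has_vector_derivative
      R'' (\<gamma> 0) (v - Q (d' 0)) (v - Q (d' 0)) + R' (\<gamma> 0) (- Q d2)) (at 0 within I)"
    by (rule second_derivative_along_curve(2)[OF R1 R2 \<gamma>T \<gamma>1 \<gamma>2 I(1)])
  have \<gamma>0: "\<gamma> 0 = 0" by (simp add: \<gamma>_def d0 Q.zero)
  have QT': "Q y \<in> T" for y using QT by blast
  have vel: "R' 0 (v - Q (d' 0)) = v - Q (d' 0)"
    using T v QT' by (intro R0 subspace_diff) auto
  have const1: "((\<lambda>s. B (R (\<gamma> s))) has_vector_derivative 0) (at s within I)" if "s \<in> I" for s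
  proof (rule has_vector_derivative_transform[OF that])
    show "B (R (\<gamma> s)) = c" if "s \<in> I" for s
      using constraint[OF that] by (simp add: \<gamma>_def)
  qed simp
  have "B (R' (\<gamma> 0) (v - Q (d' 0))) = 0"
    by (rule vector_derivative_unique_within[OF I(2)[OF I(1)]
        B.has_vector_derivative[OF along1[OF I(1)]] const1[OF I(1)]])
  then have "(B \<circ> Q) (d' 0) = (B \<circ> Q) 0"
    by (simp add: \<gamma>0 vel B.diff Bv Q.zero B.zero)
  then have d'0: "d' 0 = 0" using inj by (blast dest: injD)
  show "((\<lambda>s. R (s *\<^sub>R v - Q (d s))) has_vector_derivative v) (at 0 within I)"
    using along1[OF I(1)] unfolding \<gamma>0 d'0 Q.zero by (simp add: R0[OF v] \<gamma>_def)
  have acc: "((\<lambda>s. R' (\<gamma> s) (v - Q (d' s))) has_vector_derivative R'' 0 v v - Q d2) (at 0 within I)"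
    using along2 R0[of "- Q d2"] subspace_neg[OF T QT'] by (simp add: \<gamma>0 d'0 Q.zero)
  have "has_second_vector_derivative (\<lambda>s. R (\<gamma> s)) (R'' 0 v v - Q d2) 0 I"
    unfolding has_second_vector_derivative_def
    by (intro exI[of _ "\<lambda>s. R' (\<gamma> s) (v - Q (d' s))"] conjI ballI along1 acc)
  then show "has_second_vector_derivative (\<lambda>s. R (s *\<^sub>R v - Q (d s))) (R'' 0 v v - Q d2) 0 I"
    by (simp add: \<gamma>_def)
  have "has_second_vector_derivative (\<lambda>s. B (R (\<gamma> s))) (B (R'' 0 v v - Q d2)) 0 I"
    unfolding has_second_vector_derivative_def
    by (intro exI[of _ "\<lambda>s. B (R' (\<gamma> s) (v - Q (d' s)))"] conjI ballI
        B.has_vector_derivative along1 acc)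
  moreover have "has_second_vector_derivative (\<lambda>s. B (R (\<gamma> s))) 0 0 I"
    unfolding has_second_vector_derivative_def
    using const1 by (intro exI[of _ "\<lambda>_. 0"]) auto
  ultimately have "B (R'' 0 v v - Q d2) = 0"
    by (rule has_second_vector_derivative_unique) (use I in auto)
  then show "B (Q d2) = B (R'' 0 v v)" by (simp add: B.diff)
qed

section \<open>First and second order of the implicit retraction\<close>

theorem theorem3p1:
  fixes M :: "'e::{real_inner,complete_space} set"
    and B :: "'e \<Rightarrow> 'y::{real_inner,complete_space}"
    and c :: 'y
    and P :: "'e \<Rightarrow> 'e \<Rightarrow> 'e"
    and R :: "'e \<Rightarrow> 'e \<Rightarrow> 'e"
    and l :: "'e \<Rightarrow> 'e \<Rightarrow> 'e \<Rightarrow> 'e"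
    and r :: "'e \<Rightarrow> real"
    and \<delta> :: "'e \<Rightarrow> 'e \<Rightarrow> 'y"
    and x :: 'e
  defines "MB \<equiv> constrained_set M B c"
  assumes "C2_embedded_submanifold M"
    and "bounded_linear B" and "surj B"
    and "MB \<noteq> {}"
    and "\<And>z. z \<in> M \<Longrightarrow> bounded_projection_onto (tangent_space M z) (P z)"
    and "\<And>z. z \<in> MB \<Longrightarrow> bij (constraint_operator B (P z))"
    and "\<And>z. z \<in> M \<Longrightarrow> C2_retraction_at M z (R z)"
    and "\<And>z. z \<in> M \<Longrightarrow> symmetric_bounded_bilinear_on (tangent_space M z) (l z)"
    and "\<And>z v. z \<in> M \<Longrightarrow> v \<in> tangent_space M z \<Longrightarrow>
           has_second_vector_derivative (\<lambda>\<alpha>. R z (\<alpha> *\<^sub>R v)) (l z v v) 0 UNIV"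
    and "\<And>z. z \<in> MB \<Longrightarrow> r z > 0"
    and "\<And>z. z \<in> MB \<Longrightarrow> C2_on (\<delta> z) (implicit_domain MB z (r z))"
    and "\<And>z. z \<in> MB \<Longrightarrow> \<delta> z 0 = 0"
    and "\<And>z v. z \<in> MB \<Longrightarrow> v \<in> implicit_domain MB z (r z) \<Longrightarrow>
           B (R z (v - P z (adjoint B (\<delta> z v)))) = c"
    and "x \<in> MB"
  shows "(\<forall>v \<in> implicit_domain MB x (r x). implicit_retraction B (P x) (R x) (\<delta> x) v \<in> MB) \<and>
    (\<forall>v \<in> tangent_space MB x.
       let cB = (\<lambda>\<alpha>. implicit_retraction B (P x) (R x) (\<delta> x) (\<alpha> *\<^sub>R v));
           I = {\<alpha>. 0 \<le> \<alpha> \<and> \<alpha> * norm v < r x};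
           \<Lambda> = correction_operator B (P x)
       in cB 0 = x \<and>
          (cB has_vector_derivative v) (at 0 within I) \<and>
          (\<exists>a. has_second_vector_derivative (\<lambda>\<alpha>. R x (\<alpha> *\<^sub>R v)) a 0 UNIV \<and>
               has_second_vector_derivative cB (\<Lambda> a) 0 I \<and>
               \<Lambda> a = \<Lambda> (l x v v)))"
proof -
  note B = assms(3)
  interpret B: bounded_linear B by (fact B)
  have MB: "z \<in> MB \<longleftrightarrow> z \<in> M \<and> B z = c" for z by (simp add: MB_def constrained_set_def)
  have xM: "x \<in> M" using assms(15) MB by blast
  define T where "T = tangent_space M x"
  define Q where "Q = (\<lambda>y. P x (adjoint B y))"
  define L where "L = constraint_operator B (P x)"
  have Pbl: "bounded_linear (P x)" and PT: "range (P x) = T"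
    using assms(6)[OF xM] by (auto simp: bounded_projection_onto_def T_def)
  have Q: "bounded_linear Q"
    unfolding Q_def by (rule bounded_linear_compose[OF Pbl bounded_linear_adjoint[OF B]])
  have QT: "range Q \<subseteq> T" using PT by (auto simp: Q_def)
  have subT: "subspace T"
    using linear_subspace_image[OF bounded_linear.linear[OF Pbl] subspace_UNIV] PT by simp
  have L: "L = B \<circ> Q" by (auto simp: L_def constraint_operator_def Q_def)
  have bijL: "bij L" unfolding L_def by (rule assms(7)[OF assms(15)])
  have RM: "R x ` T \<subseteq> M" and Rx0: "R x 0 = x" and RC2: "C2_on (R x) T"
    and Rid: "(R x has_derivative (\<lambda>h. h)) (at 0 within T)"
    using assms(8)[OF xM] by (auto simp: C2_retraction_at_def T_def)
  have TMB: "tangent_space MB x \<subseteq> T"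
    unfolding T_def by (rule tangent_space_mono) (use MB in blast)
  obtain R' R'' where
    R1: "\<And>u. u \<in> T \<Longrightarrow> (R x has_derivative blinfun_apply (R' u)) (at u within T)" and
    R2: "\<And>u. u \<in> T \<Longrightarrow> (R' has_derivative blinfun_apply (R'' u)) (at u within T)"
    using RC2 unfolding C2_on_def by blast
  have R0: "R' 0 u = u" if "u \<in> T" for u
    by (rule has_derivative_within_subspace_unique[OF R1[OF subspace_0[OF subT]] Rid subT that])
  define V where "V = implicit_domain MB x (r x)"
  have ret: "implicit_retraction B (P x) (R x) (\<delta> x) v = R x (v - Q (\<delta> x v))" for v
    by (simp add: implicit_retraction_def Q_def)
  have BR: "B (R x (v - Q (\<delta> x v))) = c" if "v \<in> V" for v
    using assms(14)[OF assms(15)] that by (simp add: V_def Q_def)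
  obtain \<delta>' \<delta>'' where
    \<delta>1: "\<And>u. u \<in> V \<Longrightarrow> (\<delta> x has_derivative blinfun_apply (\<delta>' u)) (at u within V)" and
    \<delta>2: "\<And>u. u \<in> V \<Longrightarrow> (\<delta>' has_derivative blinfun_apply (\<delta>'' u)) (at u within V)"
    using assms(12)[OF assms(15)] unfolding C2_on_def V_def by blast
  have feasible: "implicit_retraction B (P x) (R x) (\<delta> x) v \<in> MB" if "v \<in> V" for v
  proof -
    have "v - Q (\<delta> x v) \<in> T"
      using that TMB QT subT by (intro subspace_diff) (auto simp: V_def implicit_domain_def)
    then show ?thesis using RM BR[OF that] by (auto simp: ret MB)
  qed
  have curve: "cB 0 = x \<and> (cB has_vector_derivative v) (at 0 within I) \<and>
      has_second_vector_derivative cB (correction_operator B (P x) (l x v v)) 0 I"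
    if v: "v \<in> tangent_space MB x"
      and cB: "cB = (\<lambda>\<alpha>. R x (\<alpha> *\<^sub>R v - Q (\<delta> x (\<alpha> *\<^sub>R v))))"
      and I: "I = {\<alpha>. 0 \<le> \<alpha> \<and> \<alpha> * norm v < r x}" for v cB I
  proof -
    have vT: "v \<in> T" using v TMB by blast
    have Bv: "B v = 0" using v tangent_space_constrained_set_in_kernel[OF B] by (simp add: MB_def)
    have rx: "0 < r x" using assms(11)[OF assms(15)] .
    have I0: "0 \<in> I" using rx by (simp add: I)
    have Inontriv: "at s within I \<noteq> bot" if "s \<in> I" for s
      using at_within_ray_nontrivial[OF rx norm_ge_zero] that by (simp add: I)
    have ray: "s *\<^sub>R v \<in> V" if "s \<in> I" for s
      using that tangent_space_scaleR[OF v] by (simp add: V_def implicit_domain_def I)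
    have line1: "((\<lambda>s. s *\<^sub>R v) has_vector_derivative v) (at s within J)" for s J
      by (auto intro!: derivative_eq_intros)
    have line2: "((\<lambda>s. v) has_vector_derivative 0) (at s within J)" for s :: real and J by simp
    define d2 where "d2 = \<delta>'' (0 *\<^sub>R v) v v + \<delta>' (0 *\<^sub>R v) 0"
    have d1: "((\<lambda>s. \<delta> x (s *\<^sub>R v)) has_vector_derivative \<delta>' (s *\<^sub>R v) v) (at s within I)"
      if "s \<in> I" for s
      by (rule second_derivative_along_curve(1)[OF \<delta>1 \<delta>2 ray line1 line2 I0 that])
    have d2: "((\<lambda>s. \<delta>' (s *\<^sub>R v) v) has_vector_derivative d2) (at 0 within I)"
      unfolding d2_def by (rule second_derivative_along_curve(2)[OF \<delta>1 \<delta>2 ray line1 line2 I0])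
    have d0: "\<delta> x (0 *\<^sub>R v) = 0" using assms(13)[OF assms(15)] by simp
    have inj: "inj (B \<circ> Q)" using bijL L by (simp add: bij_is_inj)
    have "(cB has_vector_derivative v) (at 0 within I)"
      and "has_second_vector_derivative cB (R'' 0 v v - Q d2) 0 I"
      and BQ: "B (Q d2) = B (R'' 0 v v)"
      unfolding cB
      by (rule implicit_curve_derivatives[where d="\<lambda>s. \<delta> x (s *\<^sub>R v)",
          OF subT vT R1 R2 R0 B Bv Q QT inj d0 d1 d2 I0 Inontriv BR[OF ray]]; assumption)+
    note core = this
    \<comment> \<open>The chain rule along a straight line has no velocity change, which isolates \<open>R'' 0 v v\<close>.\<close>
    have Tline: "s *\<^sub>R v \<in> T" for s :: real using subT vT by (rule subspace_scale)
    have "has_second_vector_derivative (\<lambda>s. R x (s *\<^sub>R v)) (R'' 0 v v) 0 UNIV"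
      unfolding has_second_vector_derivative_def
    proof (intro exI[of _ "\<lambda>s. R' (s *\<^sub>R v) v"] conjI ballI)
      show "((\<lambda>s. R x (s *\<^sub>R v)) has_vector_derivative R' (s *\<^sub>R v) v) (at s)" for s
        by (rule second_derivative_along_curve(1)[OF R1 R2 Tline line1 line2 UNIV_I UNIV_I])
      have "((\<lambda>s. R' (s *\<^sub>R v) v) has_vector_derivative
          R'' (0 *\<^sub>R v) v v + R' (0 *\<^sub>R v) 0) (at 0)"
        by (rule second_derivative_along_curve(2)[OF R1 R2 Tline line1 line2 UNIV_I])
      then show "((\<lambda>s. R' (s *\<^sub>R v) v) has_vector_derivative R'' 0 v v) (at 0)" by simp
    qed
    moreover have "has_second_vector_derivative (\<lambda>s. R x (s *\<^sub>R v)) (l x v v) 0 UNIV"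
      using assms(10)[OF xM] vT by (simp add: T_def)
    ultimately have lR: "R'' 0 v v = l x v v"
      by (rule has_second_vector_derivative_unique) auto
    have "L d2 = B (l x v v)" using BQ by (simp add: L lR)
    then have "d2 = inv L (B (l x v v))" using bijL by (metis bij_inv_eq_iff)
    then have "correction_operator B (P x) (l x v v) = R'' 0 v v - Q d2"
      by (simp add: correction_operator_def Q_def L_def lR)
    moreover have "cB 0 = x"
      using d0 by (simp add: cB Rx0 bounded_linear.linear[OF Q] linear_0)
    ultimately show ?thesis using core(1,2) by simp
  qed
  have second: "has_second_vector_derivative (\<lambda>\<alpha>. R x (\<alpha> *\<^sub>R v)) (l x v v) 0 UNIV"
    if "v \<in> tangent_space MB x" for v
    using assms(10)[OF xM] that TMB by (auto simp: T_def)
  show ?thesis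
    unfolding Let_def
  proof (intro conjI ballI exI)
    show "implicit_retraction B (P x) (R x) (\<delta> x) v \<in> MB"
      if "v \<in> implicit_domain MB x (r x)" for v
      using feasible that by (simp add: V_def)
  qed (use curve[OF _ refl refl] second in \<open>simp_all add: ret\<close>)
qed

end
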